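(* For integers $n\ge 0$ and $k\ge 0$, let $t(n,k)$ denote the number of maximal independent sets of size exactly $k$ in the triangular cactus $T(n)$. Then, as formal power series in $x,y$, $$\sum_{n\ge 0}\sum_{k\ge 0} t(n,k)\,x^n y^k \;=\; \frac{1+2xy+x^2y^2}{1-xy-x^2y}.$$
   Context: For $n\ge 1$, the triangular cactus $T(n)$ is the graph formed by a chain of $n$ triangles (copies of $C_3$) $B_1,\dots,B_n$, where for each $1\le i\le n-1$ the consecutive triangles $B_i$ and $B_{i+1}$ share exactly one vertex, non-consecutive triangles share no vertex, and every vertex lies in at most two triangles (so $T(n)$ has $2n+1$ vertices and its block–cut-vertex tree is a path). $T(0)$ is the empty graph, whose only maximal independent set is the empty set, so $t(0,0)=1$ and $t(0,k)=0$ for $k\ge 1$. An independent set is maximal if no further vertex can be added while keeping it independent. *)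

theory Defs
  imports "HOL-Computational_Algebra.Formal_Power_Series"
begin

text \<open>A simple graph is given by its vertex set \<open>V\<close> and its set \<open>E\<close> of two-element edges.\<close>

definition independent_set :: "'a set \<Rightarrow> 'a set set \<Rightarrow> 'a set \<Rightarrow> bool" where
  "independent_set V E S \<longleftrightarrow> S \<subseteq> V \<and> (\<forall>u\<in>S. \<forall>v\<in>S. {u, v} \<notin> E)"

definition maximal_independent_set :: "'a set \<Rightarrow> 'a set set \<Rightarrow> 'a set \<Rightarrow> bool" where
  "maximal_independent_set V E S \<longleftrightarrow>
     independent_set V E S \<and> (\<forall>v\<in>V - S. \<not> independent_set V E (insert v S))"

definition num_maximal_independent_sets :: "'a set \<Rightarrow> 'a set set \<Rightarrow> nat \<Rightarrow> nat" where
  "num_maximal_independent_sets V E k = card {S. maximal_independent_set V E S \<and> card S = k}"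

text \<open>\<open>B 1, \<dots>, B n\<close> are the vertex sets of the triangles of the chain. For \<open>n = 0\<close> the last
  two conditions force the empty graph.\<close>

definition is_triangular_cactus :: "nat \<Rightarrow> 'a set \<Rightarrow> 'a set set \<Rightarrow> bool" where
  "is_triangular_cactus n V E \<longleftrightarrow> (\<exists>B :: nat \<Rightarrow> 'a set.
     (\<forall>i\<in>{1..n}. card (B i) = 3) \<and>
     (\<forall>i. 1 \<le> i \<and> i < n \<longrightarrow> card (B i \<inter> B (i + 1)) = 1) \<and>
     (\<forall>i\<in>{1..n}. \<forall>j\<in>{1..n}. i + 1 < j \<longrightarrow> B i \<inter> B j = {}) \<and>
     (\<forall>v. card {i\<in>{1..n}. v \<in> B i} \<le> 2) \<and>
     V = (\<Union>i\<in>{1..n}. B i) \<and>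
     E = (\<Union>i\<in>{1..n}. {{u, v} | u v. u \<in> B i \<and> v \<in> B i \<and> u \<noteq> v}))"

lemma is_triangular_cactus_exists:
  "\<exists>V E. is_triangular_cactus n (V :: nat set) E"
proof -
  define B where "B = (\<lambda>i::nat. {2 * i, 2 * i + 1, 2 * i + 2})"
  have "card (B i \<inter> B (i + 1)) = 1" for i
  proof -
    have "B i \<inter> B (i + 1) = {2 * i + 2}"
      by (auto simp: B_def)
    then show ?thesis by simp
  qed
  moreover have "B i \<inter> B j = {}" if "i + 1 < j" for i j
    using that by (auto simp: B_def)
  moreover have "card {i\<in>{1..n}. v \<in> B i} \<le> 2" for v
  proof -
    have "{i\<in>{1..n}. v \<in> B i} \<subseteq> {v div 2, v div 2 - 1}"
      by (auto simp: B_def)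
    then have "card {i\<in>{1..n}. v \<in> B i} \<le> card {v div 2, v div 2 - 1}"
      by (intro card_mono) auto
    also have "\<dots> \<le> 2"
      by (simp add: card_insert_if)
    finally show ?thesis .
  qed
  moreover have "card (B i) = 3" for i
    by (simp add: B_def)
  ultimately show ?thesis
    unfolding is_triangular_cactus_def
    by (intro exI[of _ "\<Union>i\<in>{1..n}. B i"]
        exI[of _ "\<Union>i\<in>{1..n}. {{u, v} | u v. u \<in> B i \<and> v \<in> B i \<and> u \<noteq> v}"] exI[of _ B]) auto
qed

text \<open>\<open>\<rat>[[x, y]]\<close> is represented as \<open>\<rat>[[y]][[x]]\<close>: the coefficient of \<open>x\<^sup>n y\<^sup>k\<close> in \<open>F\<close> is
  \<open>fps_nth (fps_nth F n) k\<close>.\<close>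

abbreviation bfps_x :: "rat fps fps" where
  "bfps_x \<equiv> fps_X"

abbreviation bfps_y :: "rat fps fps" where
  "bfps_y \<equiv> fps_const fps_X"

text \<open>Division on \<open>rat fps fps\<close> is total; the following shows that dividing by a
  series whose constant coefficient in \<open>x\<close> is \<open>1\<close> is genuine division.\<close>

lemma bfps_divide_eq_iff:
  fixes F G H :: "rat fps fps"
  assumes "fps_nth H 0 = 1"
  shows "F = G / H \<longleftrightarrow> F * H = G"
proof -
  have inv: "H * inverse H = 1"
    using assms fps_right_inverse[of H 1] by (simp add: fps_inverse_def fps_lr_inverse_one_one)
  have sub: "subdegree H = 0"
    using assms by (intro subdegree_eq_0) simp
  have "H \<noteq> 0"
    using assms by auto
  then have div: "G / H = G * inverse H"
    using sub by (simp add: fps_divide_def)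
  show ?thesis
  proof
    assume "F = G / H"
    then have "F * H = G * (H * inverse H)"
      by (simp only: div mult_ac)
    then show "F * H = G"
      by (simp only: inv mult_1_right)
  next
    assume "F * H = G"
    then have "G / H = F * (H * inverse H)"
      by (simp only: div flip: mult.assoc)
    then show "F = G / H"
      by (simp only: inv mult_1_right)
  qed
qed

end

theory Submission imports Defs begin

text \<open>
  Every triangle of the chain has a vertex lying in no other triangle. Maximality at this vertex
  forces a maximal independent set to meet the triangle, so the maximal independent sets are exactly
  the sets of vertices meeting every triangle in one vertex. Such exact transversals are counted by
  adding the triangles one at a time, distinguishing whether the vertex shared with the next
  triangle is chosen.
\<close>

definition triangle_chain :: "nat \<Rightarrow> (nat \<Rightarrow> 'a set) \<Rightarrow> bool" where
  "triangle_chain n B \<longleftrightarrow>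
     (\<forall>i\<in>{1..n}. card (B i) = 3) \<and>
     (\<forall>i. 1 \<le> i \<and> i < n \<longrightarrow> card (B i \<inter> B (i + 1)) = 1) \<and>
     (\<forall>i\<in>{1..n}. \<forall>j\<in>{1..n}. i + 1 < j \<longrightarrow> B i \<inter> B j = {})"

definition exact_transversals :: "nat \<Rightarrow> (nat \<Rightarrow> 'a set) \<Rightarrow> 'a set set" where
  "exact_transversals n B =
     {S. S \<subseteq> (\<Union>i\<in>{1..n}. B i) \<and> (\<forall>i\<in>{1..n}. card (S \<inter> B i) = 1)}"

definition size_series :: "'a set set \<Rightarrow> rat fps" where
  "size_series A = (\<Sum>S\<in>A. fps_X ^ card S)"

lemma triangle_chain_Suc: "triangle_chain (Suc n) B \<Longrightarrow> triangle_chain n B"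
  by (auto simp: triangle_chain_def)

lemma triangle_chain_finite:
  assumes "triangle_chain n B" "i \<in> {1..n}"
  shows "finite (B i)"
  using assms by (intro card_ge_0_finite) (auto simp: triangle_chain_def)

lemma triangle_chain_disjoint:
  assumes "triangle_chain n B" "i \<in> {1..n}" "j \<in> {1..n}" "j \<noteq> i" "j \<noteq> i - 1" "j \<noteq> i + 1"
  shows "B i \<inter> B j = {}"
proof (cases "i < j")
  case True
  with assms show ?thesis by (auto simp: triangle_chain_def)
next
  case False
  with assms have "B j \<inter> B i = {}" by (auto simp: triangle_chain_def)
  then show ?thesis by blast
qed

lemma triangle_chain_private_vertex:
  assumes "triangle_chain n B" "i \<in> {1..n}"
  obtains v where "v \<in> B i" "\<And>j. j \<in> {1..n} \<Longrightarrow> v \<in> B j \<Longrightarrow> j = i"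
proof -
  define L where "L = (if 1 < i then B (i - 1) \<inter> B i else {})"
  define R where "R = (if i < n then B i \<inter> B (i + 1) else {})"
  have "card L \<le> 1"
  proof (cases "1 < i")
    case True
    then obtain m where m: "i = Suc m" "1 \<le> m" by (cases i) auto
    with assms have "card (B m \<inter> B (m + 1)) = 1" by (auto simp: triangle_chain_def)
    with m show ?thesis by (simp add: L_def)
  qed (simp add: L_def)
  moreover have "card R \<le> 1"
    using assms by (auto simp: R_def triangle_chain_def)
  ultimately have "card (L \<union> R) < card (B i)"
    using assms card_Un_le[of L R] by (auto simp: triangle_chain_def)
  moreover have "L \<union> R \<subseteq> B i" by (auto simp: L_def R_def)
  ultimately obtain v where v: "v \<in> B i" "v \<notin> L" "v \<notin> R"
    by (metis Un_iff nat_neq_iff subsetI subset_antisym)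
  have "j = i" if "j \<in> {1..n}" "v \<in> B j" for j
  proof (rule ccontr)
    assume "j \<noteq> i"
    with triangle_chain_disjoint[OF assms that(1)] v(1) that(2) have "j = i - 1 \<or> j = i + 1" by blast
    then show False
      using v that \<open>j \<noteq> i\<close> by (auto simp: L_def R_def split: if_splits)
  qed
  with v(1) that show thesis by blast
qed

lemma maximal_independent_set_iff_exact_transversal:
  fixes B :: "nat \<Rightarrow> 'a set"
  assumes chain: "triangle_chain n B"
    and V: "V = (\<Union>i\<in>{1..n}. B i)"
    and E: "E = (\<Union>i\<in>{1..n}. {{u, v} | u v. u \<in> B i \<and> v \<in> B i \<and> u \<noteq> v})"
  shows "maximal_independent_set V E S \<longleftrightarrow> S \<in> exact_transversals n B"
proof
  have edge: "{u, v} \<in> E \<longleftrightarrow> u \<noteq> v \<and> (\<exists>i\<in>{1..n}. u \<in> B i \<and> v \<in> B i)" for u v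
    unfolding E by (auto simp: doubleton_eq_iff)
  {
    assume mis: "maximal_independent_set V E S"
    then have SV: "S \<subseteq> V" and indep: "\<And>u v. u \<in> S \<Longrightarrow> v \<in> S \<Longrightarrow> {u, v} \<notin> E"
      by (auto simp: maximal_independent_set_def independent_set_def)
    have "card (S \<inter> B i) = 1" if i: "i \<in> {1..n}" for i
    proof -
      obtain v where v: "v \<in> B i" "\<And>j. j \<in> {1..n} \<Longrightarrow> v \<in> B j \<Longrightarrow> j = i"
        using triangle_chain_private_vertex[OF chain i] by metis
      have "\<exists>u. u \<in> S \<inter> B i"
      proof (cases "v \<in> S")
        case False
        have "v \<in> V" using v(1) i V by blast
        with False mis have "\<not> independent_set V E (insert v S)"
          by (auto simp: maximal_independent_set_def)
        then obtain a b where ab: "a \<in> insert v S" "b \<in> insert v S" "{a, b} \<in> E"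
          using SV \<open>v \<in> V\<close> unfolding independent_set_def by blast
        then obtain u where "u \<in> S" "{v, u} \<in> E"
          using indep edge by (metis insert_commute insert_iff)
        then show ?thesis using v edge by blast
      qed (use v in blast)
      then obtain u where "u \<in> S \<inter> B i" ..
      moreover have "w = u" if "w \<in> S \<inter> B i" for w
        using that \<open>u \<in> S \<inter> B i\<close> indep[of w u] edge i by auto
      ultimately have "S \<inter> B i = {u}" by blast
      then show ?thesis by simp
    qed
    with SV show "S \<in> exact_transversals n B"
      by (auto simp: exact_transversals_def V)
  next
    assume S: "S \<in> exact_transversals n B"
    have one: "\<exists>u. S \<inter> B i = {u}" if "i \<in> {1..n}" for i
      using S that by (auto simp: exact_transversals_def card_1_singleton_iff)
    have "{u, v} \<notin> E" if "u \<in> S" "v \<in> S" for u v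
      using one that unfolding edge by (metis IntI singletonD)
    moreover have "S \<subseteq> V" using S by (auto simp: exact_transversals_def V)
    moreover have "\<not> independent_set V E (insert v S)" if "v \<in> V - S" for v
    proof -
      obtain i where i: "i \<in> {1..n}" "v \<in> B i" using \<open>v \<in> V - S\<close> V by blast
      obtain u where "S \<inter> B i = {u}" using one[OF i(1)] by blast
      then have "u \<in> S" "{u, v} \<in> E" using i that unfolding edge by auto
      then show ?thesis by (auto simp: independent_set_def)
    qed
    ultimately show "maximal_independent_set V E S"
      by (auto simp: maximal_independent_set_def independent_set_def)
  }
qed

lemma finite_exact_transversals:
  assumes "triangle_chain n B"
  shows "finite (exact_transversals n B)" "S \<in> exact_transversals n B \<Longrightarrow> finite S"
proof -
  have fin: "finite (\<Union>i\<in>{1..n}. B i)"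
    using triangle_chain_finite[OF assms] by blast
  show "finite (exact_transversals n B)"
    by (rule finite_subset[OF _ finite_Pow_iff[THEN iffD2, OF fin]])
      (auto simp: exact_transversals_def)
  show "S \<in> exact_transversals n B \<Longrightarrow> finite S"
    using fin by (auto simp: exact_transversals_def intro: finite_subset)
qed

lemma fps_nth_size_series:
  assumes "finite A"
  shows "fps_nth (size_series A) k = of_nat (card {S\<in>A. card S = k})"
proof -
  have "fps_nth (size_series A) k = (\<Sum>S\<in>A. if card S = k then 1 else 0)"
    unfolding size_series_def fps_sum_nth by (intro sum.cong) (auto simp: fps_X_power_nth)
  also have "\<dots> = (\<Sum>S | S \<in> A \<and> card S = k. 1)"
    using assms by (intro sum.mono_neutral_cong_right) auto
  finally show ?thesis by simp
qed

lemma size_series_Un: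
  "finite A \<Longrightarrow> finite A' \<Longrightarrow> A \<inter> A' = {} \<Longrightarrow> size_series (A \<union> A') = size_series A + size_series A'"
  unfolding size_series_def by (rule sum.union_disjoint)

lemma size_series_insert:
  assumes "\<And>S. S \<in> A \<Longrightarrow> finite S \<and> p \<notin> S"
  shows "size_series (insert p ` A) = fps_X * size_series A"
proof -
  have "inj_on (insert p) A"
    using assms by (intro inj_onI) (metis insert_ident)
  then have "size_series (insert p ` A) = (\<Sum>S\<in>A. fps_X ^ card (insert p S))"
    unfolding size_series_def by (simp add: sum.reindex)
  also have "\<dots> = (\<Sum>S\<in>A. fps_X * fps_X ^ card S)"
    using assms by (intro sum.cong) auto
  finally show ?thesis by (simp add: size_series_def sum_distrib_left)
qed

lemma exact_transversals_1:
  "exact_transversals (Suc 0) B = (\<lambda>v. {v}) ` B 1"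
  by (auto simp: exact_transversals_def card_1_singleton_iff Int_absorb2)

lemma exact_transversals_Suc:
  assumes B: "B (Suc n) = {w, p, q}" and wpq: "w \<noteq> p" "w \<noteq> q" "p \<noteq> q"
    and w: "w \<in> (\<Union>i\<in>{1..n}. B i)"
    and pq: "p \<notin> (\<Union>i\<in>{1..n}. B i)" "q \<notin> (\<Union>i\<in>{1..n}. B i)"
  shows "exact_transversals (Suc n) B =
    {S\<in>exact_transversals n B. w \<in> S} \<union>
    insert p ` {S\<in>exact_transversals n B. w \<notin> S} \<union>
    insert q ` {S\<in>exact_transversals n B. w \<notin> S}" (is "_ = ?W \<union> ?P \<union> ?Q")
proof (intro equalityI subsetI)
  let ?U = "\<Union>i\<in>{1..n}. B i"
  have U: "(\<Union>i\<in>{1..Suc n}. B i) = ?U \<union> {p, q}"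
    using w by (auto simp: atLeastAtMostSuc_conv B)
  fix S
  {
    assume S: "S \<in> exact_transversals (Suc n) B"
    then have sub: "S \<subseteq> ?U \<union> {p, q}" and one: "\<And>i. i \<in> {1..Suc n} \<Longrightarrow> card (S \<inter> B i) = 1"
      unfolding exact_transversals_def U by auto
    obtain u where u: "S \<inter> {w, p, q} = {u}"
      using one[of "Suc n"] by (auto simp: B card_1_singleton_iff)
    then have u_cases: "u = w \<or> u = p \<or> u = q" by blast
    have "S - {p, q} \<in> exact_transversals n B"
    proof -
      have "(S - {p, q}) \<inter> B i = S \<inter> B i" if "i \<in> {1..n}" for i
        using pq that by blast
      with sub one show ?thesis by (auto simp: exact_transversals_def)
    qed
    moreover have "u = w \<Longrightarrow> S - {p, q} = S" "u = p \<Longrightarrow> insert p (S - {p, q}) = S"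
      "u = q \<Longrightarrow> insert q (S - {p, q}) = S"
      using u wpq by auto
    moreover have "w \<in> S \<longleftrightarrow> u = w" using u wpq by auto
    ultimately show "S \<in> ?W \<union> ?P \<union> ?Q"
      using u_cases wpq by (auto simp: image_iff)
  next
    have ext: "insert r S' \<in> exact_transversals (Suc n) B"
      if S': "S' \<in> exact_transversals n B" "w \<notin> S'" and r: "r \<in> {p, q}" for r S'
    proof -
      have sub: "S' \<subseteq> ?U" using S' by (simp add: exact_transversals_def)
      have "insert r S' \<inter> B i = S' \<inter> B i" if "i \<in> {1..n}" for i
        using pq that r by blast
      moreover have "insert r S' \<inter> {w, p, q} = {r}"
        using sub S' r pq wpq by auto
      then have "card (insert r S' \<inter> {w, p, q}) = 1" by simp
      ultimately show ?thesis
        using S' sub r unfolding exact_transversals_def U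
        by (simp add: atLeastAtMostSuc_conv B del: Int_insert_left Int_insert_right) blast
    qed
    have "S \<in> exact_transversals (Suc n) B" if S': "S \<in> exact_transversals n B" "w \<in> S"
    proof -
      have sub: "S \<subseteq> ?U" using S' by (simp add: exact_transversals_def)
      then have "S \<inter> {w, p, q} = {w}" using S' pq by auto
      then have "card (S \<inter> {w, p, q}) = 1" by simp
      then show ?thesis
        using S' sub unfolding exact_transversals_def U
        by (simp add: atLeastAtMostSuc_conv B del: Int_insert_left Int_insert_right) blast
    qed
    moreover assume "S \<in> ?W \<union> ?P \<union> ?Q"
    ultimately show "S \<in> exact_transversals (Suc n) B" using ext by blast
  }
qed

lemma card_3_obtain:
  assumes "card A = 3" "a \<in> A"
  obtains b c where "A = {a, b, c}" "a \<noteq> b" "a \<noteq> c" "b \<noteq> c"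
proof -
  have "card (A - {a}) = 2" using assms by simp
  then obtain b c where "A - {a} = {b, c}" "b \<noteq> c" by (auto simp: card_2_iff)
  with assms that[of b c] show thesis by blast
qed

text \<open>The size series of the exact transversals of \<open>n \<ge> 1\<close> triangles that avoid a given private vertex
  of the last triangle; the value at \<open>0\<close> is the one that makes the recurrence hold.\<close>

fun avoiding_series :: "nat \<Rightarrow> rat fps" where
  "avoiding_series 0 = 1"
| "avoiding_series (Suc 0) = 2 * fps_X"
| "avoiding_series (Suc (Suc n)) = fps_X * avoiding_series n + fps_X * avoiding_series (Suc n)"

lemma size_series_by_private_vertex:
  assumes "triangle_chain (Suc n) B" "v \<in> B (Suc n)" "v \<notin> (\<Union>i\<in>{1..n}. B i)"
  shows "size_series {S\<in>exact_transversals (Suc n) B. v \<in> S} = fps_X * avoiding_series n \<and>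
    size_series {S\<in>exact_transversals (Suc n) B. v \<notin> S} = avoiding_series (Suc n)"
  using assms
proof (induction n arbitrary: v)
  case 0
  then have "card (B 1) = 3" by (simp add: triangle_chain_def)
  then obtain b c where bc: "B 1 = {v, b, c}" "v \<noteq> b" "v \<noteq> c" "b \<noteq> c"
    using card_3_obtain 0 by (metis One_nat_def)
  have "{S\<in>exact_transversals (Suc 0) B. v \<in> S} = {{v}}"
    "{S\<in>exact_transversals (Suc 0) B. v \<notin> S} = {{b}, {c}}"
    unfolding exact_transversals_1 using bc by auto
  then show ?case using bc by (simp add: size_series_def)
next
  case (Suc n)
  let ?X = "exact_transversals (Suc n) B" and ?U = "\<Union>i\<in>{1..Suc n}. B i"
  note chain = triangle_chain_Suc[OF Suc.prems(1)]
  have "card (B (Suc n) \<inter> B (Suc (Suc n))) = 1" "card (B (Suc (Suc n))) = 3"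
    using Suc.prems(1) by (auto simp: triangle_chain_def)
  then obtain w where w: "B (Suc n) \<inter> B (Suc (Suc n)) = {w}"
    by (auto simp: card_1_singleton_iff)
  have disj: "B i \<inter> B (Suc (Suc n)) = {}" if "i \<in> {1..n}" for i
    using Suc.prems(1) that by (auto simp: triangle_chain_def)
  have "?U = B (Suc n) \<union> (\<Union>i\<in>{1..n}. B i)"
    by (simp add: atLeastAtMostSuc_conv)
  with w disj have U: "?U \<inter> B (Suc (Suc n)) = {w}"
    by blast
  have wn: "w \<notin> (\<Union>i\<in>{1..n}. B i)" using w disj by blast
  obtain a b where "B (Suc (Suc n)) = {v, a, b}" "v \<noteq> a" "v \<noteq> b" "a \<noteq> b"
    using card_3_obtain[OF \<open>card (B (Suc (Suc n))) = 3\<close> Suc.prems(2)] .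
  moreover have "w \<in> B (Suc (Suc n))" "w \<noteq> v" using w U Suc.prems(3) by auto
  ultimately obtain q where q: "B (Suc (Suc n)) = {w, v, q}" "w \<noteq> v" "w \<noteq> q" "v \<noteq> q"
    by (metis insertE insert_commute singletonD)
  have wU: "w \<in> ?U" and qU: "q \<notin> ?U" and vU: "v \<notin> ?U" using U q by auto
  let ?W = "{S\<in>?X. w \<in> S}" and ?N = "{S\<in>?X. w \<notin> S}"
  have X: "exact_transversals (Suc (Suc n)) B = ?W \<union> insert v ` ?N \<union> insert q ` ?N"
    using exact_transversals_Suc[OF q wU vU qU] .
  have avoid: "v \<notin> S \<and> q \<notin> S" if "S \<in> ?X" for S
    using that vU qU by (auto simp: exact_transversals_def)
  have "{S\<in>exact_transversals (Suc (Suc n)) B. v \<in> S} = insert v ` ?N"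
    "{S\<in>exact_transversals (Suc (Suc n)) B. v \<notin> S} = ?W \<union> insert q ` ?N"
    unfolding X using avoid q by auto
  moreover have "size_series (insert r ` ?N) = fps_X * size_series ?N" if "r \<in> {v, q}" for r
    using that avoid finite_exact_transversals(2)[OF chain] by (intro size_series_insert) auto
  moreover have "size_series (?W \<union> insert q ` ?N) = size_series ?W + size_series (insert q ` ?N)"
    using finite_exact_transversals(1)[OF chain] avoid by (intro size_series_Un) auto
  moreover have "w \<in> B (Suc n)" using w by blast
  ultimately show ?case using Suc.IH[OF chain _ wn] by simp
qed

lemma size_series_exact_transversals:
  assumes chain: "triangle_chain (Suc n) B"
  shows "size_series (exact_transversals (Suc n) B) = fps_X * avoiding_series n + avoiding_series (Suc n)"
proof -
  obtain v where v: "v \<in> B (Suc n)" "\<And>j. j \<in> {1..Suc n} \<Longrightarrow> v \<in> B j \<Longrightarrow> j = Suc n"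
    using triangle_chain_private_vertex[OF chain, of "Suc n"] by auto
  have "v \<notin> (\<Union>i\<in>{1..n}. B i)" using v(2) by fastforce
  note split = size_series_by_private_vertex[OF chain v(1) this]
  let ?X = "exact_transversals (Suc n) B"
  have "size_series ?X = size_series ({S\<in>?X. v \<in> S} \<union> {S\<in>?X. v \<notin> S})"
    by (rule arg_cong[of _ _ size_series]) blast
  also have "\<dots> = size_series {S\<in>?X. v \<in> S} + size_series {S\<in>?X. v \<notin> S}"
    using finite_exact_transversals(1)[OF chain] by (intro size_series_Un) auto
  finally show ?thesis using split by simp
qed

lemma cactus_size_series:
  assumes "is_triangular_cactus n V E"
  shows "Abs_fps (\<lambda>k. of_nat (num_maximal_independent_sets V E k)) =
    (case n of 0 \<Rightarrow> 1 | Suc m \<Rightarrow> fps_X * avoiding_series m + avoiding_series (Suc m))"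
proof -
  obtain B where B: "triangle_chain n B" "V = (\<Union>i\<in>{1..n}. B i)"
      "E = (\<Union>i\<in>{1..n}. {{u, v} | u v. u \<in> B i \<and> v \<in> B i \<and> u \<noteq> v})"
    using assms unfolding is_triangular_cactus_def triangle_chain_def by blast
  have "Abs_fps (\<lambda>k. of_nat (num_maximal_independent_sets V E k)) = size_series (exact_transversals n B)"
    by (rule fps_ext)
      (simp add: fps_nth_size_series finite_exact_transversals[OF B(1)]
        num_maximal_independent_sets_def maximal_independent_set_iff_exact_transversal[OF B])
  moreover have "size_series (exact_transversals 0 B) = 1"
    by (simp add: exact_transversals_def size_series_def)
  ultimately show ?thesis
    using B(1) size_series_exact_transversals by (cases n) auto
qed

theorem theorem2p1:
  fixes V :: "nat \<Rightarrow> 'a set" and E :: "nat \<Rightarrow> 'a set set" and t :: "nat \<Rightarrow> nat \<Rightarrow> nat"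
  assumes "\<And>n. is_triangular_cactus n (V n) (E n)"
    and "\<And>n k. t n k = num_maximal_independent_sets (V n) (E n) k"
  shows "Abs_fps (\<lambda>n. Abs_fps (\<lambda>k. of_nat (t n k))) =
    (1 + 2 * bfps_x * bfps_y + bfps_x\<^sup>2 * bfps_y\<^sup>2) / (1 - bfps_x * bfps_y - bfps_x\<^sup>2 * bfps_y)"
proof -
  let ?y = "fps_X :: rat fps"
  define a where "a = (\<lambda>n. case n of 0 \<Rightarrow> 1
    | Suc m \<Rightarrow> ?y * avoiding_series m + avoiding_series (Suc m))"
  define F where "F = Abs_fps a"
  have F: "Abs_fps (\<lambda>n. Abs_fps (\<lambda>k. of_nat (t n k))) = F"
    using cactus_size_series[OF assms(1)] by (simp add: F_def a_def assms(2))
  have "F * (1 - bfps_x * bfps_y - bfps_x\<^sup>2 * bfps_y) =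
      F - bfps_x * (bfps_y * F) - bfps_x\<^sup>2 * (bfps_y * F)"
    by (simp add: algebra_simps)
  also have "\<dots> = 1 + bfps_x * fps_const (2 * ?y) + bfps_x\<^sup>2 * fps_const (?y\<^sup>2)"
  proof (rule fps_ext)
    fix n
    consider "n = 0" | "n = 1" | "n = 2" | m where "n = Suc (Suc (Suc m))"
      by (metis One_nat_def Suc_1 not0_implies_Suc)
    then show "fps_nth (F - bfps_x * (bfps_y * F) - bfps_x\<^sup>2 * (bfps_y * F)) n =
        fps_nth (1 + bfps_x * fps_const (2 * ?y) + bfps_x\<^sup>2 * fps_const (?y\<^sup>2)) n"
      by cases (simp_all add: F_def a_def fps_X_power_mult_nth numeral_2_eq_2 algebra_simps)
  qed
  also have "\<dots> = 1 + 2 * bfps_x * bfps_y + bfps_x\<^sup>2 * bfps_y\<^sup>2"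
    by (simp add: fps_const_power numeral_fps_const mult_ac flip: fps_const_mult)
  finally show ?thesis
    unfolding F by (subst bfps_divide_eq_iff) simp_all
qed

end
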